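(* Let $G$ be an ordered group and let $C$ be a convex congruence on $\mathbb{B}[G]$. Then the following are equivalent: (a) $C$ is finitely generated as a congruence; (b) there exists a finite subset $A$ of $G$ such that the submonoid $\mathsf{L}(C)$ of $G$ is generated by $A$ and $\{m\in G\mid m\ge0\}$.
   Context: An ordered monoid is a commutative monoid $(\mathsf{M},+)$ with a partial order such that $a\ge b$ implies $a+c\ge b+c$; an ordered group is an ordered monoid all of whose elements are invertible. For an ordered monoid $\mathsf{M}$, $\mathbb{B}[\mathsf{M}]$ is the additively idempotent semiring whose elements are classes of finite subsets $A\subseteq\mathsf{M}$, where $A_1\sim A_2$ iff $A_1$ and $A_2$ have the same set of maximal elements; addition is $[A_1]\oplus[A_2]=[A_1\cup A_2]$ and multiplication is $[A_1]\odot[A_2]=[\{m_1+m_2\mid m_i\in A_i\}]$. The additive identity is $-\infty=[\emptyset]$, the multiplicative identity is $0=[\{0\}]$. One identifies $m\in\mathsf{M}$ with $[\{m\}]$. A congruence on a commutative semiring $S$ is a subsemiring $C\subseteq S\times S$ which is an equivalence relation on $S$. The congruence generated by a subset of $S\times S$ is the smallest congruence containing it; a congruence is finitely generated if it is generated by a finite set. For $A\subseteq G$, $\langle A\ge0\rangle$ denotes the congruence on $\mathbb{B}[G]$ generated by $\{(m\oplus0,m)\mid m\in A\}$. A convex congruence is a congruence of the form $\langle A\ge0\rangle$ for some subset $A\subseteq G$. For a congruence $C$ on $\mathbb{B}[G]$, $\mathsf{L}(C)=\{m\in G\mid (m\oplus0,m)\in C\}$, a submonoid of $G$. *)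

theory Defs
  imports Main "HOL.Hull" "HOL-Library.Set_Algebras"
begin

definition maximal_elements :: "'a::order set \<Rightarrow> 'a set" where
  "maximal_elements A = {a \<in> A. \<forall>b\<in>A. a \<le> b \<longrightarrow> b = a}"

definition same_maximals :: "'a::order set \<Rightarrow> 'a set \<Rightarrow> bool" where
  "same_maximals A B \<longleftrightarrow> finite A \<and> finite B \<and> maximal_elements A = maximal_elements B"

lemma ex_maximal_above:
  fixes A :: "'a::order set"
  assumes "finite A" "a \<in> A"
  shows "\<exists>m\<in>maximal_elements A. a \<le> m"
  using finite_has_maximal2[OF assms] by (auto simp: maximal_elements_def)

(* Used to lift the operations: among finite sets, having the same maximal elements
   amounts to each set dominating the other. *)
lemma same_maximals_iff:
  fixes A B :: "'a::order set"
  shows "same_maximals A B \<longleftrightarrow> finite A \<and> finite B \<and>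
    (\<forall>a\<in>A. \<exists>b\<in>B. a \<le> b) \<and> (\<forall>b\<in>B. \<exists>a\<in>A. b \<le> a)"
proof (cases "finite A \<and> finite B")
  case True
  have dominated: "\<forall>a\<in>X. \<exists>b\<in>Y. a \<le> b"
    if fin: "finite X" and eq: "maximal_elements X = maximal_elements Y" for X Y :: "'a set"
  proof
    fix a assume "a \<in> X"
    then obtain m where "m \<in> maximal_elements X" "a \<le> m"
      using ex_maximal_above[OF fin] by blast
    then have "m \<in> Y" unfolding eq by (simp add: maximal_elements_def)
    with \<open>a \<le> m\<close> show "\<exists>b\<in>Y. a \<le> b" ..
  qed
  have sub: "maximal_elements X \<subseteq> maximal_elements Y"
    if XY: "\<forall>a\<in>X. \<exists>b\<in>Y. a \<le> b" and YX: "\<forall>b\<in>Y. \<exists>a\<in>X. b \<le> a" for X Y :: "'a set"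
  proof
    fix m assume m: "m \<in> maximal_elements X"
    have mX: "m \<in> X" and mmax: "\<And>x. x \<in> X \<Longrightarrow> m \<le> x \<Longrightarrow> x = m"
      using m unfolding maximal_elements_def by blast+
    have eq: "y = m" if y: "y \<in> Y" "m \<le> y" for y
    proof -
      obtain x where x: "x \<in> X" "y \<le> x" using bspec[OF YX y(1)] ..
      have "x = m" by (rule mmax[OF x(1) order_trans[OF y(2) x(2)]])
      then have "y \<le> m" by (rule subst) (rule x(2))
      then show ?thesis using y(2) by (rule order_antisym)
    qed
    obtain y where y: "y \<in> Y" "m \<le> y" using bspec[OF XY mX] ..
    have "m \<in> Y" by (rule subst[OF eq[OF y]]) (rule y(1))
    moreover have "\<forall>y\<in>Y. m \<le> y \<longrightarrow> y = m" by (intro ballI impI eq)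
    ultimately show "m \<in> maximal_elements Y" unfolding maximal_elements_def by (intro CollectI conjI)
  qed
  have "maximal_elements A = maximal_elements B" if "\<forall>a\<in>A. \<exists>b\<in>B. a \<le> b" "\<forall>b\<in>B. \<exists>a\<in>A. b \<le> a"
    using sub[OF that] sub[OF that(2,1)] by (rule equalityI)
  moreover have "(\<forall>a\<in>A. \<exists>b\<in>B. a \<le> b) \<and> (\<forall>b\<in>B. \<exists>a\<in>A. b \<le> a)"
    if eq: "maximal_elements A = maximal_elements B"
    using True dominated[OF _ eq] dominated[OF _ eq[symmetric]] by (intro conjI) simp_all
  ultimately show ?thesis
    using True unfolding same_maximals_def by iprover
next
  case False
  then show ?thesis by (auto simp: same_maximals_def)
qed

(* B[M] for an ordered monoid M; the quotient is partial since only finite subsets represent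
   elements. *)
quotient_type (overloaded) 'a bool_semiring = "'a::ordered_comm_monoid_add set" / partial: same_maximals
proof (rule part_equivpI)
  show "\<exists>A :: 'a set. same_maximals A A"
    by (rule exI[of _ "{}"]) (simp add: same_maximals_def)
  show "symp (same_maximals :: 'a set \<Rightarrow> _)"
    by (auto simp: symp_def same_maximals_def)
  show "transp (same_maximals :: 'a set \<Rightarrow> _)"
    by (auto simp: transp_def same_maximals_def)
qed

(* Notational pitfall: the additive identity [{}], usually written -\<infinity>, is
   0 here, and the multiplicative identity [{0}], usually written 0, is 1 here. *)
instantiation bool_semiring :: (ordered_comm_monoid_add) comm_semiring_1
begin

lift_definition zero_bool_semiring :: "'a bool_semiring" is "{}"
  by (simp add: same_maximals_def)

lift_definition one_bool_semiring :: "'a bool_semiring" is "{0}"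
  by (simp add: same_maximals_def)

lift_definition plus_bool_semiring ::
    "'a bool_semiring \<Rightarrow> 'a bool_semiring \<Rightarrow> 'a bool_semiring" is "(\<union>)"
  unfolding same_maximals_iff ball_Un bex_Un finite_Un by simp

lift_definition times_bool_semiring ::
    "'a bool_semiring \<Rightarrow> 'a bool_semiring \<Rightarrow> 'a bool_semiring"
  is "(+)"  (* elementwise sum of sets *)
proof -
  have dominated: "\<exists>y\<in>A' + B'. x \<le> y"
    if AA': "\<forall>a\<in>A. \<exists>a'\<in>A'. a \<le> a'" and BB': "\<forall>b\<in>B. \<exists>b'\<in>B'. b \<le> b'"
      and x_in: "x \<in> A + B" for A A' B B' :: "'a set" and x
  proof -
    obtain a b where x: "x = a + b" and ab: "a \<in> A" "b \<in> B"
      using x_in by (rule set_plus_elim)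
    obtain a' where a': "a' \<in> A'" "a \<le> a'" using bspec[OF AA' ab(1)] ..
    obtain b' where b': "b' \<in> B'" "b \<le> b'" using bspec[OF BB' ab(2)] ..
    have "x \<le> a' + b'" unfolding x by (rule add_mono[OF a'(2) b'(2)])
    with set_plus_intro[OF a'(1) b'(1)] show ?thesis by (rule rev_bexI)
  qed
  fix A A' B B' :: "'a set"
  assume "same_maximals A A'" "same_maximals B B'"
  then show "same_maximals (A + B) (A' + B')"
    unfolding same_maximals_iff
    by (intro conjI ballI finite_set_plus dominated[of A A' B B'] dominated[of A' A B' B])
      simp_all
qed

instance
proof
  fix a b c :: "'a bool_semiring"
  show "a + b + c = a + (b + c)"
    by transfer (auto simp: same_maximals_def Un_assoc)
  show "a + b = b + a"
    by transfer (auto simp: same_maximals_def Un_commute)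
  show "0 + a = a"
    by transfer (auto simp: same_maximals_def)
  show "a * b * c = a * (b * c)"
    by transfer (simp add: same_maximals_def finite_set_plus add.assoc)
  show "a * b = b * a"
    by transfer (simp add: same_maximals_def finite_set_plus add.commute)
  show "1 * a = a"
    by transfer (simp add: same_maximals_def flip: set_zero)
  show "(a + b) * c = a * c + b * c"
  proof transfer
    fix A B C :: "'a set"
    assume fin: "same_maximals A A" "same_maximals B B" "same_maximals C C"
    have "(A \<union> B) + C = (A + C) \<union> (B + C)"
      by (auto simp: set_plus_def)
    with fin show "same_maximals ((A \<union> B) + C) ((A + C) \<union> (B + C))"
      by (simp add: same_maximals_def finite_set_plus)
  qed
  show "0 * a = 0"
    by transfer (simp add: same_maximals_def set_plus_def)
  show "a * 0 = 0"
    by transfer (simp add: same_maximals_def set_plus_def)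
  show "0 \<noteq> (1 :: 'a bool_semiring)"
    by transfer (auto simp: same_maximals_def maximal_elements_def)
qed

end

lift_definition of_monoid :: "'a::ordered_comm_monoid_add \<Rightarrow> 'a bool_semiring" is "\<lambda>m. {m}"
  by (simp add: same_maximals_def)

(* An equivalence relation that is a subsemiring of the product semiring S \<times> S. *)
definition is_congruence :: "('s::comm_semiring_1 \<times> 's) set \<Rightarrow> bool" where
  "is_congruence C \<longleftrightarrow> equiv UNIV C \<and> (0, 0) \<in> C \<and> (1, 1) \<in> C \<and>
    (\<forall>a b c d. (a, b) \<in> C \<longrightarrow> (c, d) \<in> C \<longrightarrow> (a + c, b + d) \<in> C \<and> (a * c, b * d) \<in> C)"

definition congruence_generated :: "('s::comm_semiring_1 \<times> 's) set \<Rightarrow> ('s \<times> 's) set" where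
  "congruence_generated X = is_congruence hull X"

definition finitely_generated_congruence :: "('s::comm_semiring_1 \<times> 's) set \<Rightarrow> bool" where
  "finitely_generated_congruence C \<longleftrightarrow> (\<exists>X. finite X \<and> C = congruence_generated X)"

(* \<langle>A \<ge> 0\<rangle>; the constant 1 is the class of the zero of G. *)
definition nonneg_congruence ::
    "'a::ordered_ab_group_add set \<Rightarrow> ('a bool_semiring \<times> 'a bool_semiring) set" where
  "nonneg_congruence A = congruence_generated {(of_monoid m + 1, of_monoid m) | m. m \<in> A}"

definition convex_congruence ::
    "('a::ordered_ab_group_add bool_semiring \<times> 'a bool_semiring) set \<Rightarrow> bool" where
  "convex_congruence C \<longleftrightarrow> (\<exists>A. C = nonneg_congruence A)"

definition L_monoid ::
    "('a::ordered_ab_group_add bool_semiring \<times> 'a bool_semiring) set \<Rightarrow> 'a set" where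
  "L_monoid C = {m. (of_monoid m + 1, of_monoid m) \<in> C}"

definition is_submonoid :: "'a::comm_monoid_add set \<Rightarrow> bool" where
  "is_submonoid N \<longleftrightarrow> 0 \<in> N \<and> (\<forall>a\<in>N. \<forall>b\<in>N. a + b \<in> N)"

definition submonoid_generated :: "'a::comm_monoid_add set \<Rightarrow> 'a set" where
  "submonoid_generated X = is_submonoid hull X"

end

theory Submission
  imports Defs
begin

text \<open>
  A submonoid \<open>N\<close> of \<open>G\<close> that contains all nonnegative elements is the same thing as a
  translation-invariant preorder on \<open>G\<close> extending the given order: put \<open>g \<le> h\<close> modulo \<open>N\<close> when
  \<open>h - g \<in> N\<close>. Identifying two finite sets when they generate the same lower set for this
  coarser preorder gives a congruence, \<open>preorder_congruence N\<close>. The submonoid is recovered from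
  it as \<open>L_monoid\<close> (\<open>L_monoid_preorder_congruence\<close>), and it is the smallest congruence whose
  \<open>L_monoid\<close> contains \<open>N\<close> (\<open>preorder_congruence_least\<close>). Hence the convex congruences are
  exactly the congruences \<open>preorder_congruence N\<close>, and \<open>\<langle>A \<ge> 0\<rangle>\<close> corresponds to the submonoid
  generated by \<open>A\<close> and the nonnegative elements (\<open>nonneg_congruence_eq\<close>).

  Under this correspondence, a finite \<open>A\<close> for \<open>N\<close> obviously yields the finitely many generating
  pairs \<open>(m \<oplus> 0, m)\<close>. Conversely, each of finitely many generating pairs of
  \<open>preorder_congruence N\<close> relates two finite sets, and that they are related modulo \<open>N\<close>
  is witnessed by finitely many differences in \<open>N\<close>. These differences and the nonnegative
  elements generate a submonoid \<open>N' \<subseteq> N\<close> whose congruence already contains the generating pairs,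
  hence all of \<open>preorder_congruence N\<close>; applying \<open>L_monoid\<close> gives \<open>N \<subseteq> N'\<close>
  (\<open>finite_generators_of_submonoid\<close>).
\<close>

section \<open>Generated congruences and submonoids\<close>

lemma is_congruence_refl: "is_congruence C \<Longrightarrow> (x, x) \<in> C"
  unfolding is_congruence_def equiv_def by (elim conjE) (erule refl_onD, rule UNIV_I)

lemma is_congruence_sym: "is_congruence C \<Longrightarrow> (x, y) \<in> C \<Longrightarrow> (y, x) \<in> C"
  unfolding is_congruence_def equiv_def by (elim conjE) (rule symD)

lemma is_congruence_trans: "is_congruence C \<Longrightarrow> (x, y) \<in> C \<Longrightarrow> (y, z) \<in> C \<Longrightarrow> (x, z) \<in> C"
  unfolding is_congruence_def equiv_def by (elim conjE) (rule transD)

lemma is_congruence_add: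
  "is_congruence C \<Longrightarrow> (x, y) \<in> C \<Longrightarrow> (z, w) \<in> C \<Longrightarrow> (x + z, y + w) \<in> C"
  unfolding is_congruence_def by iprover

lemma is_congruence_mult:
  "is_congruence C \<Longrightarrow> (x, y) \<in> C \<Longrightarrow> (z, w) \<in> C \<Longrightarrow> (x * z, y * w) \<in> C"
  unfolding is_congruence_def by iprover

lemma is_congruenceI:
  assumes "\<And>x. (x, x) \<in> C" "\<And>x y. (x, y) \<in> C \<Longrightarrow> (y, x) \<in> C"
    and "\<And>x y z. (x, y) \<in> C \<Longrightarrow> (y, z) \<in> C \<Longrightarrow> (x, z) \<in> C"
    and "\<And>x y z w. (x, y) \<in> C \<Longrightarrow> (z, w) \<in> C \<Longrightarrow> (x + z, y + w) \<in> C"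
    and "\<And>x y z w. (x, y) \<in> C \<Longrightarrow> (z, w) \<in> C \<Longrightarrow> (x * z, y * w) \<in> C"
  shows "is_congruence C"
proof -
  have "equiv UNIV C"
  proof (rule equivI)
    show "C \<subseteq> UNIV \<times> UNIV" by simp
    show "refl C" using assms(1) by (rule refl_onI)
    show "sym C" using assms(2) by (rule symI)
    show "trans C" using assms(3) by (rule transI)
  qed
  then show ?thesis
    using assms(1,4,5) by (simp add: is_congruence_def)
qed

lemma is_congruence_Inter:
  assumes C: "\<And>C. C \<in> \<C> \<Longrightarrow> is_congruence C"
  shows "is_congruence (\<Inter>\<C>)"
proof (rule is_congruenceI)
  show "(x, x) \<in> \<Inter>\<C>" for x
    using C by (intro InterI is_congruence_refl)
  show "(y, x) \<in> \<Inter>\<C>" if "(x, y) \<in> \<Inter>\<C>" for x y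
    using that by (intro InterI) (rule is_congruence_sym[OF C]; simp)
  show "(x, z) \<in> \<Inter>\<C>" if "(x, y) \<in> \<Inter>\<C>" "(y, z) \<in> \<Inter>\<C>" for x y z
    using that by (intro InterI) (rule is_congruence_trans[OF C, of _ x y z]; simp)
  show "(x + z, y + w) \<in> \<Inter>\<C>" if "(x, y) \<in> \<Inter>\<C>" "(z, w) \<in> \<Inter>\<C>" for x y z w
    using that by (intro InterI) (rule is_congruence_add[OF C]; simp)
  show "(x * z, y * w) \<in> \<Inter>\<C>" if "(x, y) \<in> \<Inter>\<C>" "(z, w) \<in> \<Inter>\<C>" for x y z w
    using that by (intro InterI) (rule is_congruence_mult[OF C]; simp)
qed

lemma is_congruence_generated: "is_congruence (congruence_generated X)"
  unfolding congruence_generated_def by (rule hull_in) (simp add: is_congruence_Inter)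

lemma subset_congruence_generated: "X \<subseteq> congruence_generated X"
  unfolding congruence_generated_def by (rule hull_subset)

lemma congruence_generated_minimal:
  "X \<subseteq> C \<Longrightarrow> is_congruence C \<Longrightarrow> congruence_generated X \<subseteq> C"
  unfolding congruence_generated_def by (rule hull_minimal)

lemma is_submonoid_generated: "is_submonoid (submonoid_generated X)"
  unfolding submonoid_generated_def by (rule hull_in) (simp add: is_submonoid_def)

lemma subset_submonoid_generated: "X \<subseteq> submonoid_generated X"
  unfolding submonoid_generated_def by (rule hull_subset)

lemma submonoid_generated_minimal:
  "X \<subseteq> N \<Longrightarrow> is_submonoid N \<Longrightarrow> submonoid_generated X \<subseteq> N"
  unfolding submonoid_generated_def by (rule hull_minimal)


section \<open>Elements of the semiring as finite sums and as lower sets\<close>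

lemma of_monoid_mult: "of_monoid a * of_monoid b = of_monoid (a + b)"
  by transfer (simp add: set_plus_def same_maximals_def)

lemma of_monoid_zero: "of_monoid 0 = 1"
  by transfer (simp add: same_maximals_def)

lemma of_monoid_add_of_le: "a \<le> b \<Longrightarrow> of_monoid b + of_monoid a = of_monoid b"
  by transfer (auto simp: same_maximals_iff)

lemma ex_finite_sum_of_monoid:
  fixes x :: "'a::ordered_comm_monoid_add bool_semiring"
  shows "\<exists>A. finite A \<and> x = (\<Sum>a\<in>A. of_monoid a)"
proof -
  have sum_eq: "abs_bool_semiring A = (\<Sum>a\<in>A. of_monoid a)" if "finite A" for A :: "'a set"
    using that
  proof (induction A rule: finite_induct)
    case empty
    show ?case by (simp add: zero_bool_semiring_def)
  next
    case (insert a A)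
    have "abs_bool_semiring (insert a A) = of_monoid a + abs_bool_semiring A"
      using insert.hyps
      by (simp add: of_monoid.abs_eq plus_bool_semiring.abs_eq eq_onp_def same_maximals_def)
    with insert show ?case by simp
  qed
  have "finite (rep_bool_semiring x)"
    using Quotient3_rep_reflp[OF Quotient3_bool_semiring, of x] by (simp add: same_maximals_def)
  then show ?thesis
    using sum_eq Quotient3_abs_rep[OF Quotient3_bool_semiring, of x] by metis
qed

text \<open>
  The lower set generated by a finite set depends only on its maximal elements, so it describes a
  class without choosing a representative.
\<close>

lift_definition down_set :: "'a::ordered_comm_monoid_add bool_semiring \<Rightarrow> 'a set"
  is "\<lambda>A. {g. \<exists>a\<in>A. g \<le> a}"
  unfolding same_maximals_iff by (blast intro: order_trans)

lemma down_set_zero: "down_set 0 = {}"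
  by transfer simp

lemma down_set_of_monoid: "down_set (of_monoid m) = {g. g \<le> m}"
  by transfer simp

lemma down_set_add: "down_set (x + y) = down_set x \<union> down_set y"
  by transfer auto

lemma down_set_mult:
  fixes x y :: "'a::ordered_ab_group_add bool_semiring"
  shows "down_set (x * y) = down_set x + down_set y"
proof (transfer, intro equalityI subsetI)
  fix A B :: "'a set" and g
  assume "g \<in> {g. \<exists>c\<in>A + B. g \<le> c}"
  then obtain a b where ab: "a \<in> A" "b \<in> B" "g \<le> a + b"
    unfolding set_plus_def by blast
  then have "g - b \<le> a" by (simp add: algebra_simps)
  with ab have "(g - b) + b \<in> {g. \<exists>a\<in>A. g \<le> a} + {g. \<exists>b\<in>B. g \<le> b}"
    by (intro set_plus_intro) auto
  then show "g \<in> {g. \<exists>a\<in>A. g \<le> a} + {g. \<exists>b\<in>B. g \<le> b}" by simp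
next
  fix A B :: "'a set" and g
  assume "g \<in> {g. \<exists>a\<in>A. g \<le> a} + {g. \<exists>b\<in>B. g \<le> b}"
  then obtain h k a b where "g = h + k" "a \<in> A" "h \<le> a" "b \<in> B" "k \<le> b"
    unfolding set_plus_def by blast
  then have "g \<le> a + b" "a + b \<in> A + B"
    by (simp_all add: add_mono set_plus_intro)
  then show "g \<in> {g. \<exists>c\<in>A + B. g \<le> c}" by blast
qed


section \<open>The congruence of a coarser preorder\<close>

text \<open>
  Submonoids with this property correspond to the translation-invariant preorders that extend the
  order of the group.
\<close>

definition is_positive_submonoid :: "'a::ordered_ab_group_add set \<Rightarrow> bool" where
  "is_positive_submonoid N \<longleftrightarrow> is_submonoid N \<and> (\<forall>m\<ge>0. m \<in> N)"

definition lower_set ::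
    "'a::ordered_ab_group_add set \<Rightarrow> 'a bool_semiring \<Rightarrow> 'a set" where
  "lower_set N x = {g. \<exists>a\<in>down_set x. a - g \<in> N}"

definition preorder_congruence ::
    "'a::ordered_ab_group_add set \<Rightarrow> ('a bool_semiring \<times> 'a bool_semiring) set" where
  "preorder_congruence N = {(x, y). lower_set N x = lower_set N y}"

lemma is_positive_submonoidD:
  assumes "is_positive_submonoid N"
  shows "0 \<in> N" "a \<in> N \<Longrightarrow> b \<in> N \<Longrightarrow> a + b \<in> N" "0 \<le> a \<Longrightarrow> a \<in> N"
  using assms by (auto simp: is_positive_submonoid_def is_submonoid_def)

lemma is_positive_submonoid_generated:
  "is_positive_submonoid (submonoid_generated (A \<union> {m. 0 \<le> m}))"
  using is_submonoid_generated subset_submonoid_generated[of "A \<union> {m. 0 \<le> m}"]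
  by (auto simp: is_positive_submonoid_def)

lemma positive_submonoid_diff_trans:
  assumes "is_positive_submonoid N" "c - b \<in> N" "b - a \<in> N"
  shows "c - a \<in> N"
  using is_positive_submonoidD(2)[OF assms] by simp

lemma lower_set_add: "lower_set N (x + y) = lower_set N x \<union> lower_set N y"
  by (auto simp: lower_set_def down_set_add)

lemma lower_set_of_monoid:
  assumes "is_positive_submonoid N"
  shows "lower_set N (of_monoid m) = {g. m - g \<in> N}"
proof -
  have "m - g \<in> N" if "a \<le> m" "a - g \<in> N" for a g
    using positive_submonoid_diff_trans[OF assms _ that(2)] is_positive_submonoidD(3)[OF assms]
      that(1) by simp
  then show ?thesis
    by (auto simp: lower_set_def down_set_of_monoid)
qed

lemma lower_set_sum_of_monoid:
  assumes "is_positive_submonoid N" "finite A"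
  shows "lower_set N (\<Sum>a\<in>A. of_monoid a) = {g. \<exists>a\<in>A. a - g \<in> N}"
  using assms(2)
proof (induction A rule: finite_induct)
  case empty
  show ?case by (simp add: lower_set_def down_set_zero)
next
  case (insert a A)
  then show ?case by (auto simp: lower_set_add lower_set_of_monoid[OF assms(1)])
qed

lemma lower_set_mult:
  assumes N: "is_positive_submonoid N"
  shows "lower_set N (x * y) = lower_set N x + lower_set N y"
proof (intro equalityI subsetI)
  fix g assume "g \<in> lower_set N (x * y)"
  then obtain a b where ab: "a \<in> down_set x" "b \<in> down_set y" "(a + b) - g \<in> N"
    by (auto simp: lower_set_def down_set_mult set_plus_def)
  have "a \<in> lower_set N x"
    using ab(1) is_positive_submonoidD(1)[OF N] by (force simp: lower_set_def)
  moreover have "g - a \<in> lower_set N y"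
    using ab(2,3) by (force simp: lower_set_def algebra_simps)
  ultimately have "a + (g - a) \<in> lower_set N x + lower_set N y"
    by (rule set_plus_intro)
  then show "g \<in> lower_set N x + lower_set N y" by simp
next
  fix g assume "g \<in> lower_set N x + lower_set N y"
  then obtain h k a b where *: "g = h + k" "a \<in> down_set x" "a - h \<in> N" "b \<in> down_set y" "b - k \<in> N"
    by (auto simp: lower_set_def set_plus_def)
  have "(a + b) - g \<in> N"
    using is_positive_submonoidD(2)[OF N *(3,5)] *(1) by (simp add: algebra_simps)
  then show "g \<in> lower_set N (x * y)"
    using *(2,4) by (auto simp: lower_set_def down_set_mult set_plus_def)
qed

text \<open>
  The relation is the kernel of \<open>lower_set N\<close>, which turns sums into unions and products into
  elementwise sums of sets.
\<close>

lemma is_congruence_preorder_congruence: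
  assumes "is_positive_submonoid N"
  shows "is_congruence (preorder_congruence N)"
  by (rule is_congruenceI)
    (simp_all add: preorder_congruence_def lower_set_add lower_set_mult[OF assms])

text \<open>
  Adding \<open>0\<close> to \<open>m\<close> leaves the lower set of \<open>m\<close> unchanged exactly when \<open>0\<close> is below \<open>m\<close> in the
  preorder given by \<open>N\<close>, that is, when \<open>m - 0 \<in> N\<close>.
\<close>

lemma L_monoid_preorder_congruence:
  assumes N: "is_positive_submonoid N"
  shows "L_monoid (preorder_congruence N) = N"
proof -
  have "m \<in> L_monoid (preorder_congruence N) \<longleftrightarrow> {g. 0 - g \<in> N} \<subseteq> {g. m - g \<in> N}" for m
    by (auto simp: L_monoid_def preorder_congruence_def lower_set_add lower_set_of_monoid[OF N]
        simp flip: of_monoid_zero)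
  moreover have "{g. 0 - g \<in> N} \<subseteq> {g. m - g \<in> N} \<longleftrightarrow> m \<in> N" for m
  proof
    assume "{g. 0 - g \<in> N} \<subseteq> {g. m - g \<in> N}"
    then have "0 - 0 \<in> N \<Longrightarrow> m - 0 \<in> N" by blast
    then show "m \<in> N" using is_positive_submonoidD(1)[OF N] by simp
  next
    assume "m \<in> N"
    then show "{g. 0 - g \<in> N} \<subseteq> {g. m - g \<in> N}"
      using positive_submonoid_diff_trans[OF N, of m 0] by auto
  qed
  ultimately show ?thesis by blast
qed

text \<open>
  Closure under addition: modulo the congruence, \<open>n\<close> absorbs \<open>0\<close> and, by translation, \<open>m + n\<close>
  absorbs \<open>n\<close>; hence \<open>m + n\<close> absorbs \<open>0\<close>.
\<close>

lemma is_positive_submonoid_L_monoid: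
  assumes C: "is_congruence C"
  shows "is_positive_submonoid (L_monoid C)"
proof -
  have nonneg: "m \<in> L_monoid C" if "0 \<le> m" for m
    using of_monoid_add_of_le[OF that] is_congruence_refl[OF C]
    by (simp add: L_monoid_def of_monoid_zero)
  have "m + n \<in> L_monoid C" if m: "m \<in> L_monoid C" and n: "n \<in> L_monoid C" for m n
  proof -
    let ?m = "of_monoid m" and ?n = "of_monoid n"
    have "((?m + 1) * ?n, ?m * ?n) \<in> C"
      using m is_congruence_mult[OF C _ is_congruence_refl[OF C]] by (simp add: L_monoid_def)
    then have mn: "(?m * ?n + ?n, ?m * ?n) \<in> C"
      by (simp add: distrib_right)
    have "(?m * ?n + (?n + 1), ?m * ?n + ?n) \<in> C"
      using n is_congruence_add[OF C is_congruence_refl[OF C]] by (simp add: L_monoid_def)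
    then have "((?m * ?n + ?n) + 1, ?m * ?n) \<in> C"
      using is_congruence_trans[OF C _ mn] by (simp add: add.assoc)
    moreover have "(?m * ?n + 1, (?m * ?n + ?n) + 1) \<in> C"
      using is_congruence_add[OF C is_congruence_sym[OF C mn] is_congruence_refl[OF C]] .
    ultimately have "(?m * ?n + 1, ?m * ?n) \<in> C"
      by (rule is_congruence_trans[OF C, rotated])
    then show ?thesis by (simp add: L_monoid_def of_monoid_mult)
  qed
  with nonneg show ?thesis
    by (auto simp: is_positive_submonoid_def is_submonoid_def)
qed

text \<open>
  If \<open>b - a\<close> lies in \<open>L_monoid C\<close>, then multiplying the pair \<open>((b - a) \<oplus> 0, b - a)\<close> by \<open>a\<close> shows
  that a sum with the summand \<open>b\<close> absorbs \<open>a\<close> modulo \<open>C\<close>. Two finite sets that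
  dominate each other thus absorb each other, and both are congruent to their union.
\<close>

lemma preorder_congruence_least:
  assumes C: "is_congruence C" and NL: "N \<subseteq> L_monoid C" and N: "is_positive_submonoid N"
  shows "preorder_congruence N \<subseteq> C"
proof -
  have absorb_one: "(y + of_monoid a, y) \<in> C" if a: "a \<in> lower_set N y" for y a
  proof -
    obtain B where B: "finite B" "y = (\<Sum>b\<in>B. of_monoid b)"
      using ex_finite_sum_of_monoid by blast
    then obtain b where b: "b \<in> B" "b - a \<in> N"
      using a by (auto simp: lower_set_sum_of_monoid[OF N])
    have y: "y = (\<Sum>b\<in>B - {b}. of_monoid b) + of_monoid b" (is "_ = ?r + _")
      unfolding B(2) using sum.remove[OF B(1) b(1)] by (simp add: add.commute)
    have "(of_monoid (b - a) + 1, of_monoid (b - a)) \<in> C"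
      using b(2) NL by (auto simp: L_monoid_def)
    from is_congruence_mult[OF C this is_congruence_refl[OF C, of "of_monoid a"]]
    have "(of_monoid b + of_monoid a, of_monoid b) \<in> C"
      by (simp add: distrib_right of_monoid_mult)
    from is_congruence_add[OF C is_congruence_refl[OF C, of ?r] this]
    show ?thesis
      by (subst (1 2) y) (simp add: add.assoc)
  qed
  have absorb: "(y + x, y) \<in> C" if sub: "lower_set N x \<subseteq> lower_set N y" for x y
  proof -
    obtain A where A: "finite A" "x = (\<Sum>a\<in>A. of_monoid a)"
      using ex_finite_sum_of_monoid by blast
    have "A \<subseteq> lower_set N x"
      using is_positive_submonoidD(1)[OF N] A by (force simp: lower_set_sum_of_monoid[OF N])
    with sub have "A \<subseteq> lower_set N y" by simp
    with A(1) have "(y + (\<Sum>a\<in>A. of_monoid a), y) \<in> C"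
    proof (induction A rule: finite_induct)
      case empty
      show ?case using is_congruence_refl[OF C] by simp
    next
      case (insert a A)
      then have IH: "(y + (\<Sum>a\<in>A. of_monoid a), y) \<in> C" by simp
      have "(y + of_monoid a, y) \<in> C" using insert.prems absorb_one by simp
      moreover have "((y + (\<Sum>a\<in>A. of_monoid a)) + of_monoid a, y + of_monoid a) \<in> C"
        using is_congruence_add[OF C IH is_congruence_refl[OF C]] .
      ultimately have "((y + (\<Sum>a\<in>A. of_monoid a)) + of_monoid a, y) \<in> C"
        by (rule is_congruence_trans[OF C, rotated])
      then show ?case using insert.hyps by (simp add: ac_simps)
    qed
    then show ?thesis unfolding A(2) .
  qed
  show ?thesis
  proof (rule subrelI)
    fix x y assume "(x, y) \<in> preorder_congruence N"
    then have "lower_set N x = lower_set N y" by (simp add: preorder_congruence_def)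
    then have "(x + y, x) \<in> C" "(x + y, y) \<in> C"
      using absorb[of x y] absorb[of y x] by (simp_all add: add.commute)
    then show "(x, y) \<in> C"
      by (rule is_congruence_trans[OF C is_congruence_sym[OF C]])
  qed
qed

lemma nonneg_congruence_eq:
  "nonneg_congruence A = preorder_congruence (submonoid_generated (A \<union> {m. 0 \<le> m}))"
  (is "?C = preorder_congruence ?N")
proof
  have N: "is_positive_submonoid ?N" by (rule is_positive_submonoid_generated)
  have C: "is_congruence ?C"
    unfolding nonneg_congruence_def by (rule is_congruence_generated)
  have "A \<subseteq> L_monoid (preorder_congruence ?N)"
    using subset_submonoid_generated[of "A \<union> {m. 0 \<le> m}"] L_monoid_preorder_congruence[OF N] by simp
  then show "?C \<subseteq> preorder_congruence ?N"
    unfolding nonneg_congruence_def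
    by (intro congruence_generated_minimal is_congruence_preorder_congruence N)
      (auto simp: L_monoid_def)
  have "A \<subseteq> L_monoid ?C"
    using subset_congruence_generated[of "{(of_monoid m + 1, of_monoid m) | m. m \<in> A}"]
    unfolding nonneg_congruence_def L_monoid_def by blast
  then have "?N \<subseteq> L_monoid ?C"
    using is_positive_submonoid_L_monoid[OF C]
    by (intro submonoid_generated_minimal) (auto simp: is_positive_submonoid_def)
  then show "preorder_congruence ?N \<subseteq> ?C"
    by (rule preorder_congruence_least[OF C _ N])
qed


section \<open>Finite generation\<close>

text \<open>
  Membership of a single pair in \<open>preorder_congruence N\<close> uses only finitely many elements of \<open>N\<close>,
  so a finite generating set sees only a finite part of \<open>N\<close> besides the nonnegative elements.
\<close>

lemma finite_generators_of_submonoid: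
  assumes N: "is_positive_submonoid N" and X: "finite X"
    and gen: "preorder_congruence N = congruence_generated X"
  shows "\<exists>F. finite F \<and> N = submonoid_generated (F \<union> {m. 0 \<le> m})"
proof -
  obtain R :: "'a bool_semiring \<Rightarrow> 'a set"
    where R: "\<And>x. finite (R x)" "\<And>x. x = (\<Sum>a\<in>R x. of_monoid a)"
    using ex_finite_sum_of_monoid by metis
  define S where "S = (\<Union>x\<in>fst ` X \<union> snd ` X. R x)"
  \<comment> \<open>The differences witnessing that the two sides of each generating pair dominate each other
    modulo \<open>N\<close> all lie in this finite set.\<close>
  define F where "F = (\<lambda>(b, a). b - a) ` (S \<times> S) \<inter> N"
  define N' where "N' = submonoid_generated (F \<union> {m. 0 \<le> m})"
  have N': "is_positive_submonoid N'"
    unfolding N'_def by (rule is_positive_submonoid_generated)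
  have "finite F" using X R(1) by (simp add: F_def S_def)
  have "F \<subseteq> N'" using subset_submonoid_generated unfolding N'_def by blast
  have lower: "lower_set M x = {g. \<exists>a\<in>R x. a - g \<in> M}" if "is_positive_submonoid M" for M x
    using lower_set_sum_of_monoid[OF that R(1)] R(2) by metis
  have transfer_le: "lower_set N' x \<subseteq> lower_set N' y"
    if le: "lower_set N x \<subseteq> lower_set N y" and sub: "R x \<subseteq> S" "R y \<subseteq> S" for x y
  proof
    fix g assume "g \<in> lower_set N' x"
    then obtain a where a: "a \<in> R x" "a - g \<in> N'" using lower[OF N'] by blast
    then have "a \<in> lower_set N x"
      using lower[OF N] is_positive_submonoidD(1)[OF N] by force
    then obtain b where b: "b \<in> R y" "b - a \<in> N" using le lower[OF N] by blast
    then have "b - a \<in> N'" using a(1) sub \<open>F \<subseteq> N'\<close> unfolding F_def by force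
    then show "g \<in> lower_set N' y"
      using b(1) positive_submonoid_diff_trans[OF N' _ a(2)] lower[OF N'] by blast
  qed
  have "X \<subseteq> preorder_congruence N'"
  proof (rule subrelI)
    fix x y assume xy: "(x, y) \<in> X"
    then have "(x, y) \<in> preorder_congruence N"
      using gen subset_congruence_generated by blast
    moreover have "R x \<subseteq> S" "R y \<subseteq> S" using xy unfolding S_def by force+
    ultimately show "(x, y) \<in> preorder_congruence N'"
      using transfer_le[of x y] transfer_le[of y x] by (auto simp: preorder_congruence_def)
  qed
  then have "preorder_congruence N \<subseteq> preorder_congruence N'"
    unfolding gen by (rule congruence_generated_minimal[OF _ is_congruence_preorder_congruence[OF N']])
  then have "L_monoid (preorder_congruence N) \<subseteq> L_monoid (preorder_congruence N')"
    unfolding L_monoid_def by blast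
  then have "N \<subseteq> N'"
    by (simp add: L_monoid_preorder_congruence N N')
  moreover have "N' \<subseteq> N"
    using N unfolding N'_def is_positive_submonoid_def
    by (intro submonoid_generated_minimal) (auto simp: F_def)
  ultimately show ?thesis using \<open>finite F\<close> unfolding N'_def by blast
qed

theorem proposition4p4:
  fixes C :: "('g::ordered_ab_group_add bool_semiring \<times> 'g bool_semiring) set"
  assumes "convex_congruence C"
  shows "finitely_generated_congruence C \<longleftrightarrow>
    (\<exists>A :: 'g set. finite A \<and> L_monoid C = submonoid_generated (A \<union> {m. 0 \<le> m}))"
proof -
  obtain B where B: "C = nonneg_congruence B"
    using assms unfolding convex_congruence_def by blast
  define N where "N = submonoid_generated (B \<union> {m. 0 \<le> m})"
  have N: "is_positive_submonoid N" unfolding N_def by (rule is_positive_submonoid_generated)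
  have C: "C = preorder_congruence N" unfolding B N_def by (rule nonneg_congruence_eq)
  have L: "L_monoid C = N" unfolding C by (rule L_monoid_preorder_congruence[OF N])
  show ?thesis
  proof
    assume "finitely_generated_congruence C"
    then show "\<exists>A. finite A \<and> L_monoid C = submonoid_generated (A \<union> {m. 0 \<le> m})"
      unfolding finitely_generated_congruence_def L
      using finite_generators_of_submonoid[OF N] C by auto
  next
    assume "\<exists>A. finite A \<and> L_monoid C = submonoid_generated (A \<union> {m. 0 \<le> m})"
    then obtain A where A: "finite A" "N = submonoid_generated (A \<union> {m. 0 \<le> m})"
      unfolding L by blast
    then have "C = nonneg_congruence A"
      unfolding C by (simp add: nonneg_congruence_eq)
    moreover have "finite {(of_monoid m + 1, of_monoid m) | m. m \<in> A}"
      using A(1) by simp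
    ultimately show "finitely_generated_congruence C"
      unfolding finitely_generated_congruence_def nonneg_congruence_def by blast
  qed
qed

end
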